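(* Let $N,M$ be finite sets with $z\in M$, $L:=M\setminus z\subset N$ and $N\setminus L=\{x,y\}$, where $x\ne y$. Let $r\in\mathbb{R}^{\mathcal{P}(M)}$ and let $T_{\uparrow\uparrow}(r)\in\mathbb{R}^{\mathcal{P}(N)}$ be its upper replication. (i) One has $m=T_{\uparrow\uparrow}(r)\in\mathcal{K}(N)$ if and only if [$r\in\mathcal{K}(M)$ and $r(L)\ge r(M)$]. The independency model induced by $m$ is then determined as follows: given $\langle a,b|C\rangle\in\mathcal{E}(N)$, the statement $a\perp b\mid C\ [m]$ is equivalent to - $a\cap L\perp b\cap L\mid z\cup(C\cap L)\ [r]$, in case $\{x,y\}\cap C\ne\emptyset$; - $a\perp b\mid C\ [r]$, in case $(a\cup b\cup C)\subseteq L$; - $z\perp\{a,b\}\cap L\mid C\ [r]$, in case $|\{x,y\}\cap\{a,b\}|=1$ and $\{x,y\}\cap C=\emptyset$; - $r(z\cup C)=r(C)$, in case $\{x,y\}=\{a,b\}$. (ii) If $r\in\mathcal{K}_u(M)$ then $T_{\uparrow\uparrow}(r)\in\mathcal{K}_u(N)$. A function $r\in\mathcal{K}_u(M)$ is extreme in $\mathcal{K}(M)$ if and only if $T_{\uparrow\uparrow}(r)$ is extreme in $\mathcal{K}(N)$. (iii) If $r$ is extreme in $\mathcal{K}(M)$ and $r(L)=r(M)$ then $T_{\uparrow\uparrow}(r)$ is extreme in $\mathcal{K}(N)$ and, moreover, $T_{\uparrow\uparrow}(r)\approx T_{\uparrow\uparrow}(r_u)$. Conversely, if $T_{\uparrow\uparrow}(r)$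 is extreme in $\mathcal{K}(N)$ then either [$r$ is extreme in $\mathcal{K}(M)$ and $r(L)=r(M)$] or one has $r(L)>r(M)$, $r\in\mathcal{L}(M)$ and $T_{\uparrow\uparrow}(r)\approx[r(L)-r(M)]\cdot v$, where $v\in\mathbb{R}^{\mathcal{P}(N)}$ is given by $v(T)=1$ if $T\subseteq L$ and $v(T)=0$ otherwise, for $T\subseteq N$.
   Context: $\mathcal{P}(N)$ is the power set of $N$; a singleton $\{a\}$ is written $a$ (so for $a\in N$, $a\cap L$ means $\{a\}\cap L$). $\mathbb{R}^{\mathcal{P}(N)}$ is the space of functions $m:\mathcal{P}(N)\to\mathbb{R}$ with scalar product $\langle m,u\rangle=\sum_{A\subseteq N}m(A)u(A)$. A function $m$ is supermodular if $m(A)+m(B)\le m(A\cup B)+m(A\cap B)$ for all $A,B\subseteq N$, modular if equality always holds; $\mathcal{K}(N)$, $\mathcal{L}(N)$ are the classes of supermodular and modular functions. For $m^1,m^2\in\mathbb{R}^{\mathcal{P}(N)}$, $m^1\approx m^2$ (quantitative equivalence) means $m^1-m^2\in\mathcal{L}(N)$. $\mathcal{E}(N)$ is the set of triplets $\langle a,b|C\rangle$ with $a,b\in N$ distinct and $C\subseteq N\setminus\{a,b\}$. For $m\in\mathbb{R}^{\mathcal{P}(N)}$ and pairwise disjoint $A,B,C\subseteq N$, $A\perp B\mid C\ [m]$ means $m(A\cup B\cup C)+m(C)-m(A\cup C)-m(B\cup C)=0$ (trivially true if $A$ or $B$ is empty). The independency model induced by $m\in\mathcal{K}(N)$ is the set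 of $\langle a,b|C\rangle\in\mathcal{E}(N)$ with $a\perp b\mid C\ [m]$. A face of a convex cone $K\subseteq\mathbb{R}^{\mathcal{P}(N)}$ is a set $\{m\in K: k=\langle m,v\rangle\}$, where $v\in\mathbb{R}^{\mathcal{P}(N)}$, $k\in\mathbb{R}$ satisfy $k\le\langle m,v\rangle$ for all $m\in K$. The non-empty faces of $\mathcal{K}(N)$ form a lattice under inclusion with least element $\mathcal{L}(N)$. A function is extreme in $\mathcal{K}(N)$ if it belongs to $\mathcal{K}(N)$ and the smallest face of $\mathcal{K}(N)$ containing it is an atom of this lattice. $\mathcal{K}_u(N)=\{m\in\mathcal{K}(N): m(N)=0,\ m(N\setminus i)=0\ \forall i\in N\}$, and for $m\in\mathbb{R}^{\mathcal{P}(N)}$ the upper standardization is $m_u(T)=m(T)+(|N|-1)m(N)-\sum_{j\in N}m(N\setminus j)+\sum_{i\in T}[m(N\setminus i)-m(N)]$ for $T\subseteq N$. All these definitions are used for other finite sets in place of $N$. The upper replication $T_{\uparrow\uparrow}:\mathbb{R}^{\mathcal{P}(M)}\to\mathbb{R}^{\mathcal{P}(N)}$ is defined, for $S\subseteq N$, by $[T_{\uparrow\uparrow}(r)](S)=r(z\cup(S\cap L))$ if $S\setminus L\ne\emptyset$, and $[T_{\uparrow\uparrow}(r)](S)=r(S)$ if $S\subseteq L$. *)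

theory Defs
  imports Complex_Main "HOL-Library.FuncSet"
begin

text \<open>
  The space of real functions on the power set of \<open>N\<close> consists of functions on sets that are
  extensional on \<open>Pow N\<close>; thus two elements of it are equal iff they agree on all subsets of \<open>N\<close>.
\<close>

definition fun_space :: "'a set \<Rightarrow> ('a set \<Rightarrow> real) set" where
  "fun_space N = Pow N \<rightarrow>\<^sub>E UNIV"

definition scalar_prod :: "'a set \<Rightarrow> ('a set \<Rightarrow> real) \<Rightarrow> ('a set \<Rightarrow> real) \<Rightarrow> real" where
  "scalar_prod N m u = (\<Sum>A\<in>Pow N. m A * u A)"

definition supermodular_funs :: "'a set \<Rightarrow> ('a set \<Rightarrow> real) set" where
  "supermodular_funs N = {m \<in> fun_space N.
     \<forall>A B. A \<subseteq> N \<longrightarrow> B \<subseteq> N \<longrightarrow> m A + m B \<le> m (A \<union> B) + m (A \<inter> B)}"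

definition modular_funs :: "'a set \<Rightarrow> ('a set \<Rightarrow> real) set" where
  "modular_funs N = {m \<in> fun_space N.
     \<forall>A B. A \<subseteq> N \<longrightarrow> B \<subseteq> N \<longrightarrow> m A + m B = m (A \<union> B) + m (A \<inter> B)}"

definition quant_equiv :: "'a set \<Rightarrow> ('a set \<Rightarrow> real) \<Rightarrow> ('a set \<Rightarrow> real) \<Rightarrow> bool" where
  "quant_equiv N m1 m2 \<longleftrightarrow> (\<lambda>A\<in>Pow N. m1 A - m2 A) \<in> modular_funs N"

definition triplets :: "'a set \<Rightarrow> ('a \<times> 'a \<times> 'a set) set" where
  "triplets N = {(a, b, C). a \<in> N \<and> b \<in> N \<and> a \<noteq> b \<and> C \<subseteq> N - {a, b}}"

text \<open>
  \<open>indep m A B C\<close> is meant for pairwise disjoint \<open>A\<close>, \<open>B\<close>, \<open>C\<close> contained in the ground set of \<open>m\<close>.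
\<close>

definition indep :: "('a set \<Rightarrow> real) \<Rightarrow> 'a set \<Rightarrow> 'a set \<Rightarrow> 'a set \<Rightarrow> bool" where
  "indep m A B C \<longleftrightarrow> m (A \<union> B \<union> C) + m C - m (A \<union> C) - m (B \<union> C) = 0"

definition indep_model :: "'a set \<Rightarrow> ('a set \<Rightarrow> real) \<Rightarrow> ('a \<times> 'a \<times> 'a set) set" where
  "indep_model N m = {(a, b, C) \<in> triplets N. indep m {a} {b} C}"

definition is_face :: "'a set \<Rightarrow> ('a set \<Rightarrow> real) set \<Rightarrow> ('a set \<Rightarrow> real) set \<Rightarrow> bool" where
  "is_face N K F \<longleftrightarrow> (\<exists>v\<in>fun_space N. \<exists>k.
     (\<forall>m\<in>K. k \<le> scalar_prod N m v) \<and> F = {m \<in> K. k = scalar_prod N m v})"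

definition nonempty_faces :: "'a set \<Rightarrow> ('a set \<Rightarrow> real) set set" where
  "nonempty_faces N = {F. is_face N (supermodular_funs N) F \<and> F \<noteq> {}}"

text \<open>
  The least element of the lattice of non-empty faces of the supermodular cone is the
  linear space of modular functions.
\<close>

definition is_atom :: "'a set \<Rightarrow> ('a set \<Rightarrow> real) set \<Rightarrow> bool" where
  "is_atom N F \<longleftrightarrow> F \<in> nonempty_faces N \<and> F \<noteq> modular_funs N \<and>
     (\<forall>G\<in>nonempty_faces N. G \<subset> F \<longrightarrow> G = modular_funs N)"

definition is_extreme :: "'a set \<Rightarrow> ('a set \<Rightarrow> real) \<Rightarrow> bool" where
  "is_extreme N m \<longleftrightarrow> m \<in> supermodular_funs N \<and>
     is_atom N (LEAST F. is_face N (supermodular_funs N) F \<and> m \<in> F)"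

definition u_standardized :: "'a set \<Rightarrow> ('a set \<Rightarrow> real) set" where
  "u_standardized N = {m \<in> supermodular_funs N. m N = 0 \<and> (\<forall>i\<in>N. m (N - {i}) = 0)}"

definition upper_std :: "'a set \<Rightarrow> ('a set \<Rightarrow> real) \<Rightarrow> 'a set \<Rightarrow> real" where
  "upper_std N m = (\<lambda>T\<in>Pow N. m T + (real (card N) - 1) * m N
     - (\<Sum>j\<in>N. m (N - {j})) + (\<Sum>i\<in>T. (m (N - {i}) - m N)))"

definition upper_repl ::
  "'a set \<Rightarrow> 'a set \<Rightarrow> 'a \<Rightarrow> ('a set \<Rightarrow> real) \<Rightarrow> 'a set \<Rightarrow> real" where
  "upper_repl N L z r = (\<lambda>S\<in>Pow N. if S - L \<noteq> {} then r ({z} \<union> (S \<inter> L)) else r S)"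

end

theory Submission
  imports Defs
begin

text \<open>
  The smallest face of the supermodular cone containing \<open>m\<close> consists of the functions that satisfy
  with equality all supermodular inequalities that \<open>m\<close> satisfies with equality. Hence \<open>m\<close> is extreme
  iff it is not modular and every supermodular \<open>f\<close> that is tight wherever \<open>m\<close> is tight is either
  modular or tight nowhere else. Upper replication composes \<open>r\<close> with the map collapsing \<open>x\<close> and \<open>y\<close>
  to \<open>z\<close>; when \<open>r L = r M\<close>, the tight pairs of \<open>r\<close> and of its replication determine each other, and
  modulo modular functions everything tight wherever the replication is tight is itself a replication.
\<close>

section \<open>Supermodularity through excesses of pairs of sets\<close>

definition excess :: "('a set \<Rightarrow> real) \<Rightarrow> 'a set \<Rightarrow> 'a set \<Rightarrow> real" where
  "excess m A B = m (A \<union> B) + m (A \<inter> B) - m A - m B"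

text \<open>Unlike membership in \<open>supermodular_funs\<close>, this ignores values outside
  \<open>Pow N\<close>, so it applies to plain lambda terms.\<close>

definition supermod :: "'a set \<Rightarrow> ('a set \<Rightarrow> real) \<Rightarrow> bool" where
  "supermod N m \<longleftrightarrow> (\<forall>A B. A \<subseteq> N \<longrightarrow> B \<subseteq> N \<longrightarrow> 0 \<le> excess m A B)"

definition tight :: "'a set \<Rightarrow> ('a set \<Rightarrow> real) \<Rightarrow> ('a set \<times> 'a set) set" where
  "tight N m = {(A, B). A \<subseteq> N \<and> B \<subseteq> N \<and> excess m A B = 0}"

lemma tight_subset: "tight N m \<subseteq> Pow N \<times> Pow N"
  by (auto simp: tight_def)

lemma supermodD: "supermod N m \<Longrightarrow> A \<subseteq> N \<Longrightarrow> B \<subseteq> N \<Longrightarrow> 0 \<le> excess m A B"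
  by (auto simp: supermod_def)

lemma mem_tight: "(A, B) \<in> tight N m \<longleftrightarrow> A \<subseteq> N \<and> B \<subseteq> N \<and> excess m A B = 0"
  by (auto simp: tight_def)

lemma excess_cong:
  assumes "\<And>S. S \<subseteq> N \<Longrightarrow> f S = g S" "A \<subseteq> N" "B \<subseteq> N"
  shows "excess f A B = excess g A B"
proof -
  have "A \<union> B \<subseteq> N" "A \<inter> B \<subseteq> N" using assms by auto
  then show ?thesis using assms by (simp add: excess_def)
qed

lemma supermod_cong: "(\<And>S. S \<subseteq> N \<Longrightarrow> f S = g S) \<Longrightarrow> supermod N f = supermod N g"
  unfolding supermod_def using excess_cong[of N f g] by auto

lemma tight_cong: "(\<And>S. S \<subseteq> N \<Longrightarrow> f S = g S) \<Longrightarrow> tight N f = tight N g"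
  unfolding tight_def using excess_cong[of N f g] by auto

lemma supermodular_funs_iff: "m \<in> supermodular_funs N \<longleftrightarrow> m \<in> fun_space N \<and> supermod N m"
  by (auto simp: supermodular_funs_def supermod_def excess_def algebra_simps)

lemma modular_funs_iff: "m \<in> modular_funs N \<longleftrightarrow> m \<in> fun_space N \<and> tight N m = Pow N \<times> Pow N"
proof -
  have "tight N m = Pow N \<times> Pow N \<longleftrightarrow> (\<forall>A B. A \<subseteq> N \<longrightarrow> B \<subseteq> N \<longrightarrow> excess m A B = 0)"
    by (auto simp: set_eq_iff mem_tight)
  also have "\<dots> \<longleftrightarrow> (\<forall>A B. A \<subseteq> N \<longrightarrow> B \<subseteq> N \<longrightarrow> m A + m B = m (A \<union> B) + m (A \<inter> B))"
    by (auto simp: excess_def algebra_simps)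
  finally show ?thesis by (simp add: modular_funs_def)
qed

lemma restrict_mem_fun_space [simp]: "restrict f (Pow N) \<in> fun_space N"
  by (auto simp: fun_space_def)

lemma supermod_restrict [simp]: "supermod N (restrict f (Pow N)) = supermod N f"
  by (rule supermod_cong) auto

lemma tight_restrict [simp]: "tight N (restrict f (Pow N)) = tight N f"
  by (rule tight_cong) auto

lemma supermod_if_all_tight: "tight N m = Pow N \<times> Pow N \<Longrightarrow> supermod N m"
  by (metis SigmaI PowI mem_tight order_refl supermod_def)

text \<open>A constant plus a sum of weights is modular, by inclusion-exclusion for sums. All later
  normalizations add a function of this shape.\<close>

lemma excess_add_sum:
  assumes "finite N" "A \<subseteq> N" "B \<subseteq> N"
  shows "excess (\<lambda>S. f S + c + (\<Sum>i\<in>S. w i)) A B = excess f A B"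
  using sum.union_inter[OF finite_subset[OF assms(2,1)] finite_subset[OF assms(3,1)], of w]
  by (simp add: excess_def)

lemma supermod_add_sum:
  "finite N \<Longrightarrow> supermod N (\<lambda>S. f S + c + (\<Sum>i\<in>S. w i)) = supermod N f"
  by (simp add: supermod_def excess_add_sum cong: conj_cong imp_cong)

lemma tight_add_sum:
  "finite N \<Longrightarrow> tight N (\<lambda>S. f S + c + (\<Sum>i\<in>S. w i)) = tight N f"
  by (auto simp: tight_def excess_add_sum)

section \<open>Faces of the supermodular cone\<close>

text \<open>Each excess is a linear form in \<open>m\<close>, so a finite sum of excesses is the
  scalar product with one vector, as the definition of a face demands.\<close>

lemma scalar_prod_sum_excess:
  assumes "finite N" "T \<subseteq> Pow N \<times> Pow N"
  obtains v where "v \<in> fun_space N"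
    "\<And>m. scalar_prod N m v = (\<Sum>(A, B)\<in>T. excess m A B)"
proof
  \<comment> \<open>\<open>e A\<close> is the standard basis vector at \<open>A\<close>: its scalar
    product with \<open>m\<close> is \<open>m A\<close>.\<close>
  define e :: "'a set \<Rightarrow> 'a set \<Rightarrow> real" where "e = (\<lambda>A S. if S = A then 1 else 0)"
  define u where "u = (\<lambda>S. \<Sum>(A, B)\<in>T. excess (\<lambda>X. e X S) A B)"
  show "restrict u (Pow N) \<in> fun_space N" by simp
  fix m
  have e: "(\<Sum>S\<in>Pow N. m S * e A S) = m A" if "A \<subseteq> N" for A
  proof -
    have "(\<Sum>S\<in>Pow N. m S * e A S) = (\<Sum>S\<in>Pow N. if S = A then m S else 0)"
      by (rule sum.cong) (auto simp: e_def)
    also have "\<dots> = m A" using assms(1) that by (simp add: sum.delta')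
    finally show ?thesis .
  qed
  have "scalar_prod N m (restrict u (Pow N))
      = (\<Sum>S\<in>Pow N. \<Sum>p\<in>T. m S * (case p of (A, B) \<Rightarrow> excess (\<lambda>X. e X S) A B))"
    unfolding scalar_prod_def u_def by (rule sum.cong) (simp_all add: sum_distrib_left)
  also have "\<dots> = (\<Sum>p\<in>T. \<Sum>S\<in>Pow N. m S * (case p of (A, B) \<Rightarrow> excess (\<lambda>X. e X S) A B))"
    by (rule sum.swap)
  also have "\<dots> = (\<Sum>(A, B)\<in>T. excess m A B)"
  proof (rule sum.cong[OF refl])
    fix p assume "p \<in> T"
    then obtain A B where p: "p = (A, B)" and sub: "A \<subseteq> N" "B \<subseteq> N"
      using assms(2) by auto
    have "(\<Sum>S\<in>Pow N. m S * excess (\<lambda>X. e X S) A B)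
        = (\<Sum>S\<in>Pow N. m S * e (A \<union> B) S) + (\<Sum>S\<in>Pow N. m S * e (A \<inter> B) S)
          - (\<Sum>S\<in>Pow N. m S * e A S) - (\<Sum>S\<in>Pow N. m S * e B S)"
      by (simp add: excess_def algebra_simps sum.distrib sum_subtractf)
    also have "\<dots> = excess m A B"
      using sub by (subst (1 2 3 4) e) (auto simp: excess_def)
    finally show "(\<Sum>S\<in>Pow N. m S * (case p of (A, B) \<Rightarrow> excess (\<lambda>X. e X S) A B))
        = (case p of (A, B) \<Rightarrow> excess m A B)"
      by (simp add: p)
  qed
  finally show "scalar_prod N m (restrict u (Pow N)) = (\<Sum>(A, B)\<in>T. excess m A B)" .
qed

lemma scalar_prod_lincomb:
  "scalar_prod N (\<lambda>A\<in>Pow N. s * f A - g A) v = s * scalar_prod N f v - scalar_prod N g v"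
  unfolding scalar_prod_def sum_distrib_left sum_subtractf[symmetric]
  by (rule sum.cong) (auto simp: algebra_simps)

text \<open>For supermodular \<open>m\<close> this is the smallest face containing
  \<open>m\<close>.\<close>

definition tight_face :: "'a set \<Rightarrow> ('a set \<Rightarrow> real) \<Rightarrow> ('a set \<Rightarrow> real) set" where
  "tight_face N m = {m' \<in> supermodular_funs N. tight N m \<subseteq> tight N m'}"

text \<open>The sum of the excesses over \<open>tight N m\<close> is a linear form that is
  nonnegative on the cone; being a sum of nonnegative terms, it vanishes only where every term
  does.\<close>

lemma is_face_tight_face:
  assumes "finite N"
  shows "is_face N (supermodular_funs N) (tight_face N m)"
proof -
  obtain v where v: "v \<in> fun_space N"
    "\<And>m'. scalar_prod N m' v = (\<Sum>(A, B)\<in>tight N m. excess m' A B)"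
    using scalar_prod_sum_excess[OF assms tight_subset] by blast
  have fin: "finite (tight N m)"
    using assms by (intro finite_subset[OF tight_subset]) simp
  have nn: "\<forall>p\<in>tight N m. 0 \<le> (case p of (A, B) \<Rightarrow> excess m' A B)"
    if "m' \<in> supermodular_funs N" for m'
    using that by (auto simp: supermodular_funs_iff mem_tight supermodD)
  have zero: "0 = scalar_prod N m' v \<longleftrightarrow> tight N m \<subseteq> tight N m'"
    if "m' \<in> supermodular_funs N" for m'
  proof -
    have "0 = scalar_prod N m' v \<longleftrightarrow> (\<forall>p\<in>tight N m. (case p of (A, B) \<Rightarrow> excess m' A B) = 0)"
      unfolding v(2) using sum_nonneg_eq_0_iff[OF fin, of "\<lambda>(A, B). excess m' A B"] nn[OF that]
      by (metis (no_types, lifting))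
    also have "\<dots> \<longleftrightarrow> tight N m \<subseteq> tight N m'"
      by (auto simp: tight_def)
    finally show ?thesis .
  qed
  have "\<forall>m'\<in>supermodular_funs N. 0 \<le> scalar_prod N m' v"
    unfolding v(2) using nn by (blast intro: sum_nonneg)
  moreover have "tight_face N m = {m' \<in> supermodular_funs N. 0 = scalar_prod N m' v}"
    using zero by (auto simp: tight_face_def)
  ultimately show ?thesis
    unfolding is_face_def using v(1) by blast
qed

text \<open>The witness is the sum of all ratios \<open>g s / f s\<close>, which also covers empty
  \<open>S\<close>. Where \<open>f s = 0\<close> the ratio is 0 by convention, and
  \<open>g s = 0\<close> as well.\<close>

lemma finite_dominate:
  fixes f g :: "'b \<Rightarrow> real"
  assumes "finite S" "\<And>s. s \<in> S \<Longrightarrow> 0 \<le> f s" "\<And>s. s \<in> S \<Longrightarrow> 0 \<le> g s"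
    "\<And>s. s \<in> S \<Longrightarrow> f s = 0 \<Longrightarrow> g s = 0"
  obtains t where "0 \<le> t" "\<And>s. s \<in> S \<Longrightarrow> g s \<le> t * f s"
proof
  show "0 \<le> (\<Sum>s\<in>S. g s / f s)"
    using assms by (intro sum_nonneg) simp
  fix s assume s: "s \<in> S"
  have "g s = g s / f s * f s" using assms(4)[OF s] by auto
  also have "\<dots> \<le> (\<Sum>s\<in>S. g s / f s) * f s"
    using assms s by (intro mult_right_mono member_le_sum) auto
  finally show "g s \<le> (\<Sum>s\<in>S. g s / f s) * f s" .
qed

text \<open>If \<open>m'\<close> is tight wherever \<open>m\<close> is, then \<open>t \<cdot> m - m'\<close> stays in the cone for large \<open>t\<close>,
  so a linear form that is minimal at \<open>m\<close> is minimal at \<open>m'\<close> as well.\<close>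

lemma tight_face_least:
  assumes "finite N" and F: "is_face N (supermodular_funs N) F" and "m \<in> F"
  shows "tight_face N m \<subseteq> F"
proof
  fix m' assume "m' \<in> tight_face N m"
  then have m': "m' \<in> supermodular_funs N" "supermod N m'" and sub: "tight N m \<subseteq> tight N m'"
    by (auto simp: tight_face_def supermodular_funs_iff)
  obtain v k where k: "\<And>f. f \<in> supermodular_funs N \<Longrightarrow> k \<le> scalar_prod N f v"
    and F_eq: "F = {f \<in> supermodular_funs N. k = scalar_prod N f v}"
    using F by (auto simp: is_face_def)
  have m: "m \<in> supermodular_funs N" "supermod N m" "k = scalar_prod N m v"
    using \<open>m \<in> F\<close> by (auto simp: F_eq supermodular_funs_iff)
  \<comment> \<open>The cone is closed under nonnegative scaling; the factors 0 and 2 then force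
    \<open>k = 0\<close>. The subtracted 0 below gives the terms the form required by
    \<open>scalar_prod_lincomb\<close>.\<close>
  have zero_mult: "k \<le> s * k" if "0 \<le> s" for s
  proof -
    have "excess (\<lambda>A. s * m A - 0) A B = s * excess m A B" for A B
      by (simp add: excess_def algebra_simps)
    then have "supermod N (\<lambda>A. s * m A - 0)"
      using m(2) that by (simp only: supermod_def) simp
    then have "(\<lambda>A\<in>Pow N. s * m A - (\<lambda>_. 0) A) \<in> supermodular_funs N"
      by (simp add: supermodular_funs_iff del: diff_zero)
    from k[OF this] have "k \<le> s * k - scalar_prod N (\<lambda>_. 0) v"
      by (simp only: scalar_prod_lincomb m(3))
    then show ?thesis by (simp add: scalar_prod_def)
  qed
  have k0: "k = 0" using zero_mult[of 0] zero_mult[of 2] by simp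
  obtain t where t: "0 \<le> t"
    "\<And>p. p \<in> Pow N \<times> Pow N \<Longrightarrow>
      (case p of (A, B) \<Rightarrow> excess m' A B) \<le> t * (case p of (A, B) \<Rightarrow> excess m A B)"
  proof (rule finite_dominate[of "Pow N \<times> Pow N" "\<lambda>(A, B). excess m A B" "\<lambda>(A, B). excess m' A B"])
    show "finite (Pow N \<times> Pow N)" using assms(1) by simp
    show "(case p of (A, B) \<Rightarrow> excess m' A B) = 0"
      if "p \<in> Pow N \<times> Pow N" "(case p of (A, B) \<Rightarrow> excess m A B) = 0" for p
      using that sub by (auto simp: tight_def)
  qed (use m(2) m'(2) in \<open>auto simp: supermodD\<close>)
  have "excess (\<lambda>A. t * m A - m' A) A B = t * excess m A B - excess m' A B" for A B
    by (simp add: excess_def algebra_simps)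
  then have "supermod N (\<lambda>A. t * m A - m' A)"
    using t(2) by (auto simp: supermod_def)
  then have "(\<lambda>A\<in>Pow N. t * m A - m' A) \<in> supermodular_funs N"
    by (simp add: supermodular_funs_iff)
  \<comment> \<open>The form vanishes at \<open>m\<close>, so its value at \<open>t * m - m'\<close>
    is minus its value at \<open>m'\<close>.\<close>
  from k[OF this] have "scalar_prod N m' v \<le> 0"
    using m(3) k0 by (simp add: scalar_prod_lincomb)
  then show "m' \<in> F" using k[OF m'(1)] m'(1) k0 by (auto simp: F_eq)
qed

lemma Least_face:
  assumes "finite N" "m \<in> supermodular_funs N"
  shows "(LEAST F. is_face N (supermodular_funs N) F \<and> m \<in> F) = tight_face N m"
proof (rule Least_equality)
  show "is_face N (supermodular_funs N) (tight_face N m) \<and> m \<in> tight_face N m"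
    using assms is_face_tight_face by (auto simp: tight_face_def)
qed (use assms(1) tight_face_least in blast)

lemma modular_subset_tight_face: "modular_funs N \<subseteq> tight_face N m"
  using tight_subset[of N m]
  by (auto simp: tight_face_def modular_funs_iff supermodular_funs_iff supermod_if_all_tight)

lemma tight_face_modular:
  assumes "m \<in> modular_funs N"
  shows "tight_face N m = modular_funs N"
proof (rule antisym[OF _ modular_subset_tight_face])
  show "tight_face N m \<subseteq> modular_funs N"
  proof
    fix f assume "f \<in> tight_face N m"
    then show "f \<in> modular_funs N"
      using assms tight_subset[of N f]
      by (simp add: tight_face_def modular_funs_iff supermodular_funs_iff)
  qed
qed

text \<open>A face contains the tight face of each of its points, so the atom condition need only be
  tested on tight faces. From here on extremity is a matter of comparing tight sets.\<close>

lemma is_extreme_iff: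
  assumes "finite N"
  shows "is_extreme N m \<longleftrightarrow> m \<in> fun_space N \<and> supermod N m \<and> tight N m \<noteq> Pow N \<times> Pow N \<and>
    (\<forall>f. supermod N f \<longrightarrow> tight N m \<subseteq> tight N f \<longrightarrow>
      tight N f = Pow N \<times> Pow N \<or> tight N f \<subseteq> tight N m)" (is "_ \<longleftrightarrow> ?R")
proof (cases "m \<in> supermodular_funs N")
  case False
  then show ?thesis by (auto simp: is_extreme_def supermodular_funs_iff)
next
  case True
  then have ms: "m \<in> fun_space N" "supermod N m" by (auto simp: supermodular_funs_iff)
  have self: "f \<in> tight_face N f" if "f \<in> supermodular_funs N" for f
    using that by (simp add: tight_face_def)
  have ne: "tight_face N f \<in> nonempty_faces N" if "f \<in> supermodular_funs N" for f
    using is_face_tight_face[OF assms] self[OF that] by (auto simp: nonempty_faces_def)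
  have ext: "is_extreme N m \<longleftrightarrow> is_atom N (tight_face N m)"
    using True by (simp add: is_extreme_def Least_face[OF assms True])
  show ?thesis
  proof
    assume "is_extreme N m"
    then have atom: "tight_face N m \<noteq> modular_funs N"
      "\<And>G. G \<in> nonempty_faces N \<Longrightarrow> G \<subset> tight_face N m \<Longrightarrow> G = modular_funs N"
      unfolding ext is_atom_def by auto
    have "tight N f = Pow N \<times> Pow N \<or> tight N f \<subseteq> tight N m"
      if f: "supermod N f" "tight N m \<subseteq> tight N f" for f
    proof -
      \<comment> \<open>Restriction moves \<open>f\<close> into \<open>fun_space N\<close> and keeps
        its tight pairs.\<close>
      define g where "g = restrict f (Pow N)"
      have g: "g \<in> supermodular_funs N" "tight N g = tight N f"
        using f by (auto simp: supermodular_funs_iff g_def)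
      have "tight_face N g \<subseteq> tight_face N m"
        using f g by (auto simp: tight_face_def)
      then consider "tight_face N g = tight_face N m" | "tight_face N g = modular_funs N"
        using atom(2)[OF ne[OF g(1)]] by blast
      then show ?thesis
      proof cases
        case 1
        then have "m \<in> tight_face N g" using self[OF True] by simp
        then show ?thesis using g by (simp add: tight_face_def)
      next
        case 2
        then show ?thesis using self[OF g(1)] g(2) by (simp add: modular_funs_iff)
      qed
    qed
    moreover have "tight N m \<noteq> Pow N \<times> Pow N"
      using atom(1) tight_face_modular ms(1) by (auto simp: modular_funs_iff)
    ultimately show ?R using ms by blast
  next
    assume R: ?R
    then have "m \<notin> modular_funs N" by (simp add: modular_funs_iff)
    then have 1: "tight_face N m \<noteq> modular_funs N" using self[OF True] by blast
    have "G = modular_funs N" if G: "G \<in> nonempty_faces N" "G \<subset> tight_face N m" for G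
    proof (rule ccontr)
      assume neq: "G \<noteq> modular_funs N"
      have face: "is_face N (supermodular_funs N) G" and "G \<noteq> {}"
        using G(1) by (auto simp: nonempty_faces_def)
      then have "modular_funs N \<subseteq> G"
        using tight_face_least[OF assms face] modular_subset_tight_face by blast
      \<comment> \<open>The tight face of a non-modular \<open>f\<close> in \<open>G\<close>
        contains that of \<open>m\<close> and lies in \<open>G\<close>, so \<open>G\<close> cannot
        be a proper part of \<open>tight_face N m\<close>.\<close>
      then obtain f where f: "f \<in> G" "f \<notin> modular_funs N" using neq by blast
      have fm: "f \<in> tight_face N m" using f(1) G(2) by blast
      then have "f \<in> fun_space N" "supermod N f" "tight N m \<subseteq> tight N f"
        by (auto simp: tight_face_def supermodular_funs_iff)
      with R f(2) have "tight N f \<subseteq> tight N m" by (metis modular_funs_iff)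
      then have "tight_face N m \<subseteq> tight_face N f" by (auto simp: tight_face_def)
      also have "\<dots> \<subseteq> G" using tight_face_least[OF assms face f(1)] .
      finally show False using G(2) by blast
    qed
    then show "is_extreme N m"
      unfolding ext is_atom_def using 1 ne[OF True] by blast
  qed
qed

section \<open>Upper replication\<close>

locale replication =
  fixes N M L :: "'a set" and x y z :: 'a
  assumes fin_N: "finite N" and fin_M: "finite M" and z_in: "z \<in> M" and L_eq: "L = M - {z}"
    and L_sub: "L \<subseteq> N" and N_diff: "N - L = {x, y}" and x_neq_y: "x \<noteq> y"
begin

abbreviation repl :: "('a set \<Rightarrow> real) \<Rightarrow> 'a set \<Rightarrow> real" where
  "repl r \<equiv> upper_repl N L z r"

text \<open>For \<open>S \<subseteq> N\<close>, the image of \<open>S\<close> under the map that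
  fixes \<open>L\<close> and sends \<open>x\<close> and \<open>y\<close> to
  \<open>z\<close>.\<close>

definition collapse :: "'a set \<Rightarrow> 'a set" where
  "collapse S = S \<inter> L \<union> (if S \<subseteq> L then {} else {z})"

text \<open>For \<open>A \<subseteq> M\<close>, the preimage of \<open>A\<close> under the same map;
  hence it respects both unions and intersections.\<close>

definition expand :: "'a set \<Rightarrow> 'a set" where
  "expand A = A \<inter> L \<union> (if z \<in> A then {x, y} else {})"

lemma M_eq: "M = insert z L" and N_eq: "N = L \<union> {x, y}"
  and z_notin: "z \<notin> L" and x_notin: "x \<notin> L" and y_notin: "y \<notin> L"
  and x_in: "x \<in> N" and y_in: "y \<in> N"
  using z_in L_eq L_sub N_diff by auto

lemma repl_collapse: "S \<subseteq> N \<Longrightarrow> repl r S = r (collapse S)"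
  by (auto simp: upper_repl_def collapse_def intro!: arg_cong[of _ _ r])

lemma collapse_subset: "collapse S \<subseteq> M" and expand_subset: "expand A \<subseteq> N"
  by (auto simp: collapse_def expand_def M_eq N_eq)

lemma collapse_expand: "A \<subseteq> M \<Longrightarrow> collapse (expand A) = A"
  using z_notin x_notin y_notin by (auto simp: collapse_def expand_def M_eq split: if_splits)

lemma expand_Un: "expand (A \<union> B) = expand A \<union> expand B"
  and expand_Int: "expand (A \<inter> B) = expand A \<inter> expand B"
  using x_notin y_notin by (auto simp: expand_def)

lemma collapse_Un: "collapse (A \<union> B) = collapse A \<union> collapse B"
  by (auto simp: collapse_def)

text \<open>Nothing is identified inside \<open>L\<close>, so only \<open>z\<close> can be lost;
  this happens when \<open>A\<close> and \<open>B\<close> both leave \<open>L\<close> but their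
  intersection does not.\<close>

lemma collapse_Int:
  "collapse (A \<inter> B) = collapse A \<inter> collapse B \<or>
   z \<in> collapse A \<inter> collapse B \<and> collapse (A \<inter> B) = collapse A \<inter> collapse B - {z}"
  using z_notin by (auto simp: collapse_def)

lemma repl_expand: "A \<subseteq> M \<Longrightarrow> repl r (expand A) = r A"
  using expand_subset by (simp add: repl_collapse collapse_expand)

lemma excess_expand: "excess f (expand A) (expand B) = excess (\<lambda>S. f (expand S)) A B"
  by (simp add: excess_def expand_Un expand_Int)

lemma excess_repl_expand:
  assumes "A \<subseteq> M" "B \<subseteq> M"
  shows "excess (repl r) (expand A) (expand B) = excess r A B"
  unfolding excess_expand using assms by (intro excess_cong[of M]) (auto simp: repl_expand)

text \<open>\<open>collapse\<close> preserves unions but not intersections: \<open>A\<close> and \<open>B\<close> may meet \<open>{x, y}\<close> in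
  different elements. The correction is then governed by the pair \<open>(L, collapse A \<inter> collapse B)\<close>.\<close>

lemma excess_repl:
  assumes "A \<subseteq> N" "B \<subseteq> N"
  shows "excess (repl r) A B = excess r (collapse A) (collapse B) +
    (if collapse (A \<inter> B) = collapse A \<inter> collapse B then 0
     else excess r L (collapse A \<inter> collapse B) + (r L - r M))"
proof -
  let ?D = "collapse A \<inter> collapse B"
  have "A \<union> B \<subseteq> N" "A \<inter> B \<subseteq> N" using assms by auto
  then have 1: "excess (repl r) A B =
      excess r (collapse A) (collapse B) + (r (collapse (A \<inter> B)) - r ?D)"
    using assms by (simp add: excess_def repl_collapse collapse_Un)
  show ?thesis
  proof (cases "collapse (A \<inter> B) = ?D")
    case False
    then have D: "z \<in> ?D" "collapse (A \<inter> B) = ?D - {z}" using collapse_Int[of A B] by auto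
    \<comment> \<open>The excess of \<open>(L, ?D)\<close> contains \<open>r M - r L\<close>, which
      the extra summand \<open>r L - r M\<close> cancels.\<close>
    have "L \<union> ?D = M" "L \<inter> ?D = ?D - {z}"
      using D(1) collapse_subset[of A] z_notin by (auto simp: M_eq)
    then have "excess r L ?D + (r L - r M) = r (?D - {z}) - r ?D"
      by (simp add: excess_def)
    then show ?thesis unfolding 1 using False D(2) by simp
  qed (simp add: 1)
qed

text \<open>Both sets collapse to \<open>M\<close> while their intersection is \<open>L\<close>.
  This pair detects the one condition on \<open>r\<close> beyond supermodularity.\<close>

lemma excess_repl_top: "excess (repl r) (insert x L) (insert y L) = r L - r M"
proof -
  have "collapse (insert x L) = M" "collapse (insert y L) = M"
    "collapse (insert x L \<inter> insert y L) = L"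
    using x_notin y_notin x_neq_y by (auto simp: collapse_def M_eq)
  moreover have "L \<union> M = M" "L \<inter> M = L" "L \<noteq> M" using z_notin by (auto simp: M_eq)
  ultimately show ?thesis
    using x_in y_in L_sub by (subst excess_repl) (auto simp: excess_def)
qed

text \<open>Expanded pairs and the top pair give one direction; for the other, every summand in
  \<open>excess_repl\<close> is nonnegative.\<close>

lemma supermod_repl: "supermod N (repl r) \<longleftrightarrow> supermod M r \<and> r M \<le> r L"
proof
  assume *: "supermod N (repl r)"
  have "supermod M r"
    unfolding supermod_def
    using supermodD[OF * expand_subset expand_subset] by (metis excess_repl_expand)
  moreover have "0 \<le> excess (repl r) (insert x L) (insert y L)"
    using x_in y_in L_sub by (intro supermodD[OF *]) auto
  ultimately show "supermod M r \<and> r M \<le> r L" by (simp add: excess_repl_top)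
next
  assume *: "supermod M r \<and> r M \<le> r L"
  have "0 \<le> excess r (collapse A) (collapse B)" "0 \<le> excess r L (collapse A \<inter> collapse B)" for A B
    using * collapse_subset by (auto intro!: supermodD[of M] simp: L_eq)
  then show "supermod N (repl r)"
    unfolding supermod_def using * by (auto simp: excess_repl)
qed

section \<open>Tight pairs of a replication\<close>

lemma mem_tight_repl_expand:
  assumes "A \<subseteq> M" "B \<subseteq> M"
  shows "(expand A, expand B) \<in> tight N (repl r) \<longleftrightarrow> (A, B) \<in> tight M r"
  using assms expand_subset by (simp add: mem_tight excess_repl_expand)

text \<open>When \<open>r L = r M\<close>, the excess in \<open>excess_repl\<close> is a sum of
  nonnegative excesses of \<open>r\<close>, so it vanishes iff each of them does.\<close>

lemma mem_tight_repl:
  assumes "supermod M r" "r L = r M" "A \<subseteq> N" "B \<subseteq> N"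
  shows "(A, B) \<in> tight N (repl r) \<longleftrightarrow> (collapse A, collapse B) \<in> tight M r \<and>
    (collapse (A \<inter> B) = collapse A \<inter> collapse B \<or> (L, collapse A \<inter> collapse B) \<in> tight M r)"
proof -
  have sub: "L \<subseteq> M" "collapse A \<inter> collapse B \<subseteq> M" using collapse_subset[of A] L_eq by auto
  have "0 \<le> excess r (collapse A) (collapse B)" "0 \<le> excess r L (collapse A \<inter> collapse B)"
    using assms(1) collapse_subset sub by (auto intro!: supermodD[of M])
  then show ?thesis
    using assms sub collapse_subset by (auto simp: mem_tight excess_repl)
qed

text \<open>Expanded pairs carry the inclusion down to \<open>M\<close>. Upwards, the criterion of
  \<open>mem_tight_repl\<close> is monotone in the tight set on \<open>M\<close>.\<close>

lemma tight_repl_mono_iff: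
  assumes "supermod M r" "r L = r M" "supermod M s" "s L = s M"
  shows "tight N (repl r) \<subseteq> tight N (repl s) \<longleftrightarrow> tight M r \<subseteq> tight M s"
proof
  assume *: "tight N (repl r) \<subseteq> tight N (repl s)"
  show "tight M r \<subseteq> tight M s"
  proof (rule subrelI)
    fix A B assume AB: "(A, B) \<in> tight M r"
    then have sub: "A \<subseteq> M" "B \<subseteq> M" by (auto simp: mem_tight)
    from AB have "(expand A, expand B) \<in> tight N (repl s)"
      using * mem_tight_repl_expand[OF sub] by blast
    then show "(A, B) \<in> tight M s" by (simp add: mem_tight_repl_expand[OF sub])
  qed
next
  assume *: "tight M r \<subseteq> tight M s"
  show "tight N (repl r) \<subseteq> tight N (repl s)"
  proof (rule subrelI)
    fix A B assume AB: "(A, B) \<in> tight N (repl r)"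
    then have "A \<subseteq> N" "B \<subseteq> N" by (auto simp: mem_tight)
    with AB * show "(A, B) \<in> tight N (repl s)"
      unfolding mem_tight_repl[OF assms(1,2) \<open>A \<subseteq> N\<close> \<open>B \<subseteq> N\<close>]
        mem_tight_repl[OF assms(3,4) \<open>A \<subseteq> N\<close> \<open>B \<subseteq> N\<close>] by blast
  qed
qed

text \<open>The zero function is tight everywhere on both ground sets, so this is
  \<open>tight_repl_mono_iff\<close> with zero on the left.\<close>

lemma all_tight_repl_iff:
  assumes "supermod M r" "r L = r M"
  shows "tight N (repl r) = Pow N \<times> Pow N \<longleftrightarrow> tight M r = Pow M \<times> Pow M"
proof -
  have 0: "tight M (\<lambda>_. 0) = Pow M \<times> Pow M" "tight N (repl (\<lambda>_. 0)) = Pow N \<times> Pow N"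
    "supermod M (\<lambda>_. 0)"
    by (auto simp: tight_def excess_def supermod_def upper_repl_def)
  have "Pow N \<times> Pow N \<subseteq> tight N (repl r) \<longleftrightarrow> Pow M \<times> Pow M \<subseteq> tight M r"
    using tight_repl_mono_iff[OF 0(3) refl assms] unfolding 0 .
  then show ?thesis
    by (simp only: set_eq_subset tight_subset simp_thms)
qed

text \<open>After subtracting a modular function, everything above \<open>repl r\<close> is again a replication:
  the pairs \<open>(L \<union> {y}, C \<union> {x, y})\<close> and their mirror images are tight for \<open>repl r\<close>.\<close>

lemma repl_if_tight_superset:
  assumes "supermod N f" "r L = r M" "tight N (repl r) \<subseteq> tight N f"
  obtains s where "supermod M s" "s L = s M" "tight N (repl s) = tight N f"
proof -
  \<comment> \<open>These weights make \<open>g\<close> take the same value at \<open>N\<close>,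
    \<open>N - {x}\<close> and \<open>N - {y}\<close>, namely
    \<open>f (N - {x}) + f (N - {y}) - f N\<close>. The \<open>+ 0\<close> in \<open>g\<close> fits
    the shape of \<open>supermod_add_sum\<close>.\<close>
  define w where "w = (\<lambda>i. if i \<in> {x, y} then f (N - {i}) - f N else 0)"
  define g where "g = (\<lambda>S. f S + 0 + (\<Sum>i\<in>S. w i))"
  define s where "s = (\<lambda>A. g (expand A))"
  have g: "supermod N g" "tight N g = tight N f"
    unfolding g_def using assms(1) fin_N by (simp_all only: supermod_add_sum tight_add_sum)
  have Nx: "N - {x} = insert y L" and Ny: "N - {y} = insert x L" and Nxy: "N = insert x (insert y L)"
    using N_eq x_notin y_notin x_neq_y by auto
  have finL: "finite L" using fin_N L_sub finite_subset by blast
  have w0: "(\<Sum>i\<in>C. w i) = 0" if "C \<subseteq> L" for C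
    using that x_notin y_notin by (intro sum.neutral) (auto simp: w_def)
  have sums: "(\<Sum>i\<in>insert x L. w i) = w x" "(\<Sum>i\<in>insert y L. w i) = w y"
    "(\<Sum>i\<in>insert x (insert y L). w i) = w x + w y"
    using finL x_notin y_notin x_neq_y w0[of L] by auto
  have gN: "g (insert x L) = g N" "g (insert y L) = g N"
    unfolding g_def Nxy sums by (simp_all add: w_def Nx Ny flip: Nxy)
  \<comment> \<open>Hence \<open>g\<close> does not distinguish whether \<open>C\<close> is joined
    by \<open>x\<close>, by \<open>y\<close> or by both, so it is recovered from its values on
    expanded sets.\<close>
  have step: "g (insert i C) = g (insert i (insert j C))"
    if C: "C \<subseteq> L" and ij: "{i, j} = {x, y}" for C i j
  proof -
    let ?A = "insert i L" and ?B = "insert i (insert j C)"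
    have sub: "?A \<subseteq> N" "?B \<subseteq> N" and ij': "i \<notin> L" "j \<notin> L" "i \<noteq> j" "N = insert i (insert j L)"
      using C ij N_eq x_notin y_notin x_neq_y by (auto simp: doubleton_eq_iff)
    have un: "?A \<union> ?B = N" and int: "?A \<inter> ?B = insert i C" using C ij' by auto
    \<comment> \<open>The collapses agree in pairs, so the excess of \<open>repl r\<close> at
      \<open>(?A, ?B)\<close> cancels; since \<open>g ?A = g N\<close>, tightness for
      \<open>g\<close> then equates the other two values.\<close>
    have c: "collapse N = M" "collapse ?A = M" "collapse ?B = insert z C" "collapse (insert i C) = insert z C"
      using C ij' by (auto simp: collapse_def M_eq)
    have "N \<subseteq> N" "insert i C \<subseteq> N" using sub C by auto
    then have "excess (repl r) ?A ?B = 0"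
      unfolding excess_def un int using sub by (simp add: repl_collapse c)
    then have "(?A, ?B) \<in> tight N (repl r)" using sub by (simp add: mem_tight)
    then have "(?A, ?B) \<in> tight N g" using assms(3) g(2) by blast
    moreover have "g ?A = g N" using gN ij by (auto simp: doubleton_eq_iff)
    ultimately show ?thesis unfolding mem_tight excess_def un int by linarith
  qed
  have repl_s: "repl s S = g S" if S: "S \<subseteq> N" for S
  proof -
    define C where "C = S \<inter> L"
    have C: "C \<subseteq> L" by (simp add: C_def)
    have "S = C \<or> S = insert x C \<or> S = insert y C \<or> S = insert x (insert y C)"
      using S by (auto simp: C_def N_eq)
    moreover have "repl s S = g (expand (collapse S))" using S by (simp add: repl_collapse s_def)
    moreover have "expand C = C" "expand (insert z C) = insert x (insert y C)"
      using C z_notin by (auto simp: expand_def)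
    moreover have "collapse C = C" "collapse (insert x C) = insert z C" "collapse (insert y C) = insert z C"
      "collapse (insert x (insert y C)) = insert z C"
      using C x_notin y_notin by (auto simp: collapse_def)
    ultimately show ?thesis
      using step[OF C, of x y] step[OF C, of y x] by (auto simp: insert_commute)
  qed
  have sN: "supermod N (repl s)" "tight N (repl s) = tight N f"
    using supermod_cong[of N "repl s" g, OF repl_s] tight_cong[of N "repl s" g, OF repl_s] g by auto
  \<comment> \<open>Here \<open>r L = r M\<close> enters: it makes the top pair tight for
    \<open>repl r\<close>, hence for \<open>repl s\<close>, which means
    \<open>s L = s M\<close>.\<close>
  have "(insert x L, insert y L) \<in> tight N (repl r)"
    using assms(2) excess_repl_top x_in y_in L_sub by (auto simp: mem_tight)
  then have "(insert x L, insert y L) \<in> tight N (repl s)"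
    using assms(3) sN(2) by blast
  then have "s L = s M" by (simp add: mem_tight excess_repl_top)
  with sN show ?thesis using that supermod_repl by blast
qed

section \<open>Extremity of replications\<close>

text \<open>A multiple of the modular indicator of \<open>z\<close> equalizes the values at
  \<open>L\<close> and \<open>M\<close>, bringing any function within reach of the comparison
  lemmas. The formula for \<open>s\<close> is exported for the case
  \<open>r M < r L\<close>.\<close>

lemma ex_equalized:
  obtains s where "s = (\<lambda>S. r S + (\<Sum>i\<in>S. if i = z then r L - r M else 0))"
    "s L = s M" "supermod M s = supermod M r" "tight M s = tight M r"
proof
  let ?w = "\<lambda>i. if i = z then r L - r M else 0"
  show "(\<lambda>S. r S + (\<Sum>i\<in>S. ?w i)) = (\<lambda>S. r S + (\<Sum>i\<in>S. ?w i))" ..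
  have "finite L" using fin_N L_sub finite_subset by blast
  then show "r L + (\<Sum>i\<in>L. ?w i) = r M + (\<Sum>i\<in>M. ?w i)"
    using z_notin z_in fin_M by simp
qed (use supermod_add_sum[OF fin_M, of r 0] tight_add_sum[OF fin_M, of r 0] in simp_all)

lemma repl_in_fun_space [simp]: "repl r \<in> fun_space N"
  by (simp add: upper_repl_def)

text \<open>Competitors are transported both ways: from \<open>M\<close> to \<open>N\<close> by
  equalizing and replicating, from \<open>N\<close> to \<open>M\<close> by
  \<open>repl_if_tight_superset\<close>.\<close>

lemma is_extreme_repl_iff:
  assumes "r \<in> fun_space M" "r L = r M"
  shows "is_extreme N (repl r) \<longleftrightarrow> is_extreme M r"
proof (cases "supermod M r")
  case False
  then show ?thesis
    by (simp add: is_extreme_iff fin_N fin_M supermod_repl)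
next
  case r: True
  show ?thesis
  proof
    assume ext: "is_extreme N (repl r)"
    have "tight M f = Pow M \<times> Pow M \<or> tight M f \<subseteq> tight M r"
      if f: "supermod M f" "tight M r \<subseteq> tight M f" for f
    proof -
      obtain s where s: "s L = s M" "supermod M s" "tight M s = tight M f"
        using ex_equalized[of f] f(1) by metis
      have "supermod N (repl s)" using s by (simp add: supermod_repl)
      moreover have "tight N (repl r) \<subseteq> tight N (repl s)"
        using tight_repl_mono_iff[OF r assms(2) s(2,1)] s(3) f(2) by simp
      ultimately have "tight N (repl s) = Pow N \<times> Pow N \<or> tight N (repl s) \<subseteq> tight N (repl r)"
        using ext[unfolded is_extreme_iff[OF fin_N]] by simp
      then show ?thesis
        using tight_repl_mono_iff[OF s(2,1) r assms(2)] all_tight_repl_iff[OF s(2,1)] s(3) by simp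
    qed
    moreover have "tight M r \<noteq> Pow M \<times> Pow M"
      using ext all_tight_repl_iff[OF r assms(2)] by (simp add: is_extreme_iff fin_N)
    ultimately show "is_extreme M r"
      using r assms(1) by (simp add: is_extreme_iff fin_M)
  next
    assume ext: "is_extreme M r"
    have "tight N f = Pow N \<times> Pow N \<or> tight N f \<subseteq> tight N (repl r)"
      if f: "supermod N f" "tight N (repl r) \<subseteq> tight N f" for f
    proof -
      obtain s where s: "supermod M s" "s L = s M" "tight N (repl s) = tight N f"
        using repl_if_tight_superset[OF f(1) assms(2) f(2)] .
      have "tight M r \<subseteq> tight M s"
        using tight_repl_mono_iff[OF r assms(2) s(1,2)] s(3) f(2) by simp
      then have "tight M s = Pow M \<times> Pow M \<or> tight M s \<subseteq> tight M r"
        using ext[unfolded is_extreme_iff[OF fin_M]] s(1) by simp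
      then show ?thesis
        using tight_repl_mono_iff[OF s(1,2) r assms(2)] all_tight_repl_iff[OF s(1,2)] s(3) by simp
    qed
    moreover have "tight N (repl r) \<noteq> Pow N \<times> Pow N"
      using ext all_tight_repl_iff[OF r assms(2)] by (simp add: is_extreme_iff fin_M)
    moreover have "supermod N (repl r)" using r assms(2) by (simp add: supermod_repl)
    ultimately show "is_extreme N (repl r)"
      by (simp add: is_extreme_iff fin_N)
  qed
qed

section \<open>Upper standardization\<close>

text \<open>\<open>N\<close>, \<open>N - {x}\<close> and \<open>N - {y}\<close> all collapse to
  \<open>M\<close>, and removing \<open>i\<close> from \<open>N\<close> for \<open>i \<in> L\<close>
  collapses to \<open>M - {i}\<close>. The equality \<open>r L = r M\<close> is standardization at
  \<open>z\<close>.\<close>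

lemma repl_u_standardized:
  assumes "r \<in> u_standardized M"
  shows "repl r \<in> u_standardized N" and "r L = r M"
proof -
  have r: "supermod M r" "r M = 0" "\<And>i. i \<in> M \<Longrightarrow> r (M - {i}) = 0"
    using assms by (auto simp: u_standardized_def supermodular_funs_iff)
  show "r L = r M" using r(2) r(3)[OF z_in] L_eq by simp
  then have "repl r \<in> supermodular_funs N"
    using r(1) by (simp add: supermodular_funs_iff supermod_repl)
  moreover have "collapse N = M"
    using x_notin by (auto simp: collapse_def N_eq M_eq)
  then have "repl r N = 0" by (simp add: repl_collapse r(2))
  moreover have "repl r (N - {i}) = 0" if "i \<in> N" for i
  proof -
    have "i \<in> L \<or> i = x \<or> i = y" using that by (auto simp: N_eq)
    moreover have "collapse (N - {i}) = M - {i}" if "i \<in> L"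
      using x_notin y_notin z_notin that by (auto simp: collapse_def N_eq M_eq)
    moreover have "collapse (N - {x}) = M"
      using x_notin y_notin x_neq_y by (auto simp: collapse_def N_eq M_eq)
    moreover have "collapse (N - {y}) = M"
      using x_notin y_notin x_neq_y by (auto simp: collapse_def N_eq M_eq)
    ultimately have "r (collapse (N - {i})) = 0" using r(2) r(3)[of i] by (auto simp: L_eq)
    moreover have "N - {i} \<subseteq> N" by auto
    ultimately show ?thesis by (simp add: repl_collapse)
  qed
  ultimately show "repl r \<in> u_standardized N" by (simp add: u_standardized_def)
qed

text \<open>Standardizing changes \<open>r\<close> by a constant and a sum of weights. As
  \<open>r L = r M\<close>, the weight of \<open>z\<close> is zero, so pulling the change back to
  \<open>N\<close> again gives a constant plus weights, supported on \<open>L\<close>.\<close>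

lemma repl_quant_equiv_upper_std:
  assumes "r L = r M"
  shows "quant_equiv N (repl r) (repl (upper_std M r))"
proof -
  define c where "c = (\<Sum>j\<in>M. r (M - {j})) - (real (card M) - 1) * r M"
  define w where "w = (\<lambda>i. if i \<in> L then r M - r (M - {i}) else 0)"
  have *: "repl r S - repl (upper_std M r) S = 0 + c + (\<Sum>i\<in>S. w i)" if S: "S \<subseteq> N" for S
  proof -
    have fin: "finite S" using S fin_N finite_subset by blast
    have "(\<Sum>i\<in>S. w i) = (\<Sum>i\<in>S \<inter> L. r M - r (M - {i}))"
      using fin by (simp add: w_def sum.inter_restrict)
    \<comment> \<open>A possible term for \<open>z\<close> is \<open>r M - r L = 0\<close>.\<close>
    also have "\<dots> = (\<Sum>i\<in>collapse S. r M - r (M - {i}))"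
      using assms fin z_notin by (simp add: collapse_def flip: L_eq)
    also have "\<dots> = - (\<Sum>i\<in>collapse S. r (M - {i}) - r M)"
      by (simp flip: sum_negf)
    finally show ?thesis
      using S collapse_subset[of S] by (simp add: repl_collapse upper_std_def c_def)
  qed
  have "tight N (\<lambda>S. repl r S - repl (upper_std M r) S) = tight N (\<lambda>S. 0 + c + (\<Sum>i\<in>S. w i))"
    by (rule tight_cong) (rule *)
  also have "\<dots> = tight N (\<lambda>S. 0)" using fin_N by (rule tight_add_sum)
  also have "\<dots> = Pow N \<times> Pow N" by (auto simp: tight_def excess_def)
  finally show ?thesis by (simp add: quant_equiv_def modular_funs_iff)
qed

text \<open>If \<open>r M < r L\<close>, then up to a constant \<open>repl r\<close> is the sum of the replication of the equalized
  \<open>r\<close> and a positive multiple of the indicator of \<open>Pow L\<close>; extremity kills the first summand.\<close>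

lemma extreme_repl_degenerate:
  assumes ext: "is_extreme N (repl r)" and less: "r M < r L" and r_fs: "r \<in> fun_space M"
    and v_eq: "v = (\<lambda>T\<in>Pow N. if T \<subseteq> L then 1 else 0)"
  shows "r \<in> modular_funs M"
    and "quant_equiv N (repl r) (\<lambda>T\<in>Pow N. (r L - r M) * v T)"
proof -
  define k where "k = r L - r M"
  have k: "0 < k" using less by (simp add: k_def)
  obtain s where s: "s = (\<lambda>S. r S + (\<Sum>i\<in>S. if i = z then r L - r M else 0))"
    "s L = s M" "supermod M s = supermod M r" "tight M s = tight M r"
    using ex_equalized .
  have m: "supermod N (repl r)"
    "\<And>f. supermod N f \<Longrightarrow> tight N (repl r) \<subseteq> tight N f \<Longrightarrow>
      tight N f = Pow N \<times> Pow N \<or> tight N f \<subseteq> tight N (repl r)"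
    using ext by (auto simp: is_extreme_iff fin_N)
  have r: "supermod M r" using m(1) by (simp add: supermod_repl)
  have ms: "supermod N (repl s)" using r s by (simp add: supermod_repl)
  \<comment> \<open>Equalizing adds \<open>k\<close> exactly on the sets that leave
    \<open>L\<close>.\<close>
  have repl_s: "repl s S = repl r S + k - k * v S" if S: "S \<subseteq> N" for S
  proof -
    have "finite (collapse S)" using collapse_subset fin_M finite_subset by blast
    then have "s (collapse S) = r (collapse S) + (if z \<in> collapse S then k else 0)"
      by (simp add: s(1) k_def sum.delta)
    moreover have "z \<in> collapse S \<longleftrightarrow> \<not> S \<subseteq> L" using z_notin by (simp add: collapse_def)
    ultimately show ?thesis using S by (simp add: repl_collapse v_eq)
  qed
  have exc: "excess (repl r) A B = excess (repl s) A B + k * excess v A B"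
    if "A \<subseteq> N" "B \<subseteq> N" for A B
  proof -
    have "A \<union> B \<subseteq> N" "A \<inter> B \<subseteq> N" using that by auto
    then show ?thesis using that by (simp add: excess_def repl_s algebra_simps)
  qed
  \<comment> \<open>If \<open>A\<close> and \<open>B\<close> both lie in \<open>L\<close>, so do
    union and intersection; if only one does, the intersection still does.\<close>
  have v: "supermod N v"
    unfolding supermod_def excess_def v_eq by auto
  have sum0: "excess (repl s) A B = 0 \<and> excess v A B = 0" if AB: "(A, B) \<in> tight N (repl r)" for A B
  proof -
    have sub: "A \<subseteq> N" "B \<subseteq> N" and "excess (repl r) A B = 0" using AB by (auto simp: mem_tight)
    then have "excess (repl s) A B + k * excess v A B = 0" using exc by simp
    moreover have "0 \<le> excess (repl s) A B" "0 \<le> k * excess v A B"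
      using supermodD[OF ms sub] supermodD[OF v sub] k by auto
    ultimately show ?thesis using k by (simp add: add_nonneg_eq_0_iff)
  qed
  let ?A = "insert x L" and ?B = "insert y L"
  have top_sub: "?A \<subseteq> N" "?B \<subseteq> N" using x_in y_in L_sub by auto
  \<comment> \<open>The top pair is tight for \<open>repl s\<close> but not for
    \<open>repl r\<close>, so extremity leaves only full tightness of \<open>repl s\<close>.\<close>
  have "(?A, ?B) \<in> tight N (repl s)"
    using top_sub s(2) by (simp add: mem_tight excess_repl_top)
  moreover have "(?A, ?B) \<notin> tight N (repl r)"
    using less by (simp add: mem_tight excess_repl_top)
  moreover have "tight N (repl r) \<subseteq> tight N (repl s)"
    using sum0 by (intro subrelI) (simp add: mem_tight)
  ultimately have all_s: "tight N (repl s) = Pow N \<times> Pow N"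
    using m(2)[OF ms] by blast
  then show "r \<in> modular_funs M"
    using all_tight_repl_iff[of s] s r r_fs by (simp add: modular_funs_iff)
  have "excess (\<lambda>S. repl r S - k * v S) A B = excess (repl r) A B - k * excess v A B" for A B
    by (simp add: excess_def algebra_simps)
  then have "tight N (\<lambda>S. repl r S - k * v S) = tight N (repl s)"
    using exc by (auto simp: tight_def)
  moreover have "tight N (\<lambda>S. repl r S - (\<lambda>T\<in>Pow N. k * v T) S) = tight N (\<lambda>S. repl r S - k * v S)"
    by (rule tight_cong) auto
  ultimately show "quant_equiv N (repl r) (\<lambda>T\<in>Pow N. (r L - r M) * v T)"
    using all_s by (simp add: quant_equiv_def modular_funs_iff k_def)
qed

section \<open>The induced independency model\<close>

text \<open>Each case is read off from the collapses of the four sets in the statement.\<close>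

lemma indep_model_repl:
  assumes "(a, b, C) \<in> triplets N"
  shows "{x, y} \<inter> C \<noteq> {} \<Longrightarrow> (a, b, C) \<in> indep_model N (repl r) \<longleftrightarrow>
      indep r ({a} \<inter> L) ({b} \<inter> L) ({z} \<union> (C \<inter> L))" (is "_ \<Longrightarrow> ?thesis1")
    and "{a} \<union> {b} \<union> C \<subseteq> L \<Longrightarrow> (a, b, C) \<in> indep_model N (repl r) \<longleftrightarrow> indep r {a} {b} C"
      (is "_ \<Longrightarrow> ?thesis2")
    and "card ({x, y} \<inter> {a, b}) = 1 \<and> {x, y} \<inter> C = {} \<Longrightarrow>
      (a, b, C) \<in> indep_model N (repl r) \<longleftrightarrow> indep r {z} ({a, b} \<inter> L) C" (is "_ \<Longrightarrow> ?thesis3")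
    and "{x, y} = {a, b} \<Longrightarrow> (a, b, C) \<in> indep_model N (repl r) \<longleftrightarrow> r ({z} \<union> C) = r C"
      (is "_ \<Longrightarrow> ?thesis4")
proof -
  have abC: "a \<in> N" "b \<in> N" "a \<noteq> b" "C \<subseteq> N" "a \<notin> C" "b \<notin> C" using assms by (auto simp: triplets_def)
  have "{a} \<union> {b} \<union> C \<subseteq> N" "{a} \<union> C \<subseteq> N" "{b} \<union> C \<subseteq> N" using abC by auto
  note repl_eq = this[THEN repl_collapse] repl_collapse[OF \<open>C \<subseteq> N\<close>]
  have "(a, b, C) \<in> indep_model N (repl r) \<longleftrightarrow> indep (repl r) {a} {b} C"
    using assms by (simp add: indep_model_def)
  then have iff: "(a, b, C) \<in> indep_model N (repl r) \<longleftrightarrow>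
      r (collapse ({a} \<union> {b} \<union> C)) + r (collapse C) - r (collapse ({a} \<union> C)) - r (collapse ({b} \<union> C)) = 0"
    unfolding indep_def repl_eq .
  show ?thesis1 if "{x, y} \<inter> C \<noteq> {}"
  proof -
    have z: "collapse ({a} \<union> {b} \<union> C) = {a} \<inter> L \<union> {b} \<inter> L \<union> ({z} \<union> (C \<inter> L))"
      "collapse C = {z} \<union> (C \<inter> L)" "collapse ({a} \<union> C) = {a} \<inter> L \<union> ({z} \<union> (C \<inter> L))"
      "collapse ({b} \<union> C) = {b} \<inter> L \<union> ({z} \<union> (C \<inter> L))"
      using that x_notin y_notin by (auto simp: collapse_def)
    show ?thesis unfolding iff z indep_def ..
  qed
  show ?thesis2 if "{a} \<union> {b} \<union> C \<subseteq> L"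
  proof -
    have z: "collapse ({a} \<union> {b} \<union> C) = {a} \<union> {b} \<union> C" "collapse C = C"
      "collapse ({a} \<union> C) = {a} \<union> C" "collapse ({b} \<union> C) = {b} \<union> C"
      using that by (auto simp: collapse_def)
    show ?thesis unfolding iff z indep_def ..
  qed
  show ?thesis4 if ab: "{x, y} = {a, b}"
  proof -
    have CL: "C \<subseteq> L" using ab abC by (auto simp: N_eq)
    have "a \<notin> L" "b \<notin> L" using ab x_notin y_notin by (auto simp: doubleton_eq_iff)
    then have z: "collapse ({a} \<union> {b} \<union> C) = {z} \<union> C" "collapse C = C"
      "collapse ({a} \<union> C) = {z} \<union> C" "collapse ({b} \<union> C) = {z} \<union> C"
      using CL by (auto simp: collapse_def)
    show ?thesis unfolding iff z by auto
  qed
  show ?thesis3 if h: "card ({x, y} \<inter> {a, b}) = 1 \<and> {x, y} \<inter> C = {}"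
  proof -
    have CL: "C \<subseteq> L" using h abC by (auto simp: N_eq)
    then have cC: "collapse C = C" by (auto simp: collapse_def)
    obtain u where u: "{x, y} \<inter> {a, b} = {u}" by (rule card_1_singletonE[OF conjunct1[OF h]])
    \<comment> \<open>Exactly one of \<open>a\<close> and \<open>b\<close> lies outside
      \<open>L\<close>, namely \<open>u\<close>; it becomes \<open>z\<close>.\<close>
    have iff_L: "c \<notin> L \<longleftrightarrow> c = u" if "c \<in> {a, b}" for c
    proof -
      have "c \<notin> L \<longleftrightarrow> c \<in> {x, y}" using that abC(1,2) x_notin y_notin by (auto simp: N_eq)
      also have "\<dots> \<longleftrightarrow> c \<in> {x, y} \<inter> {a, b}" using that by blast
      finally show ?thesis unfolding u by blast
    qed
    have "u = a \<or> u = b" using u by blast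
    then consider "a \<notin> L" "b \<in> L" | "b \<notin> L" "a \<in> L"
      using iff_L[of a] iff_L[of b] abC(3) by auto
    then show ?thesis
    proof cases
      case 1
      then have z: "collapse ({a} \<union> {b} \<union> C) = {z} \<union> {a, b} \<inter> L \<union> C"
        "collapse ({a} \<union> C) = {z} \<union> C" "collapse ({b} \<union> C) = {a, b} \<inter> L \<union> C"
        using CL by (auto simp: collapse_def)
      show ?thesis unfolding iff z cC indep_def ..
    next
      case 2
      then have z: "collapse ({a} \<union> {b} \<union> C) = {z} \<union> {a, b} \<inter> L \<union> C"
        "collapse ({b} \<union> C) = {z} \<union> C" "collapse ({a} \<union> C) = {a, b} \<inter> L \<union> C"
        using CL by (auto simp: collapse_def)
      \<comment> \<open>With \<open>b\<close> in the role of \<open>z\<close>, the two subtracted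
        values come in the opposite order.\<close>
      show ?thesis unfolding iff z cC indep_def by linarith
    qed
  qed
qed

end

theorem mainTheorem10:
  fixes N M L :: "'a set" and x y z :: 'a and r m v :: "'a set \<Rightarrow> real"
  assumes "finite N" and "finite M"
    and "z \<in> M" and "L = M - {z}" and "L \<subset> N" and "N - L = {x, y}" and "x \<noteq> y"
    and "r \<in> fun_space M"
    and m_eq: "m = upper_repl N L z r"
    and v_eq: "v = (\<lambda>T\<in>Pow N. if T \<subseteq> L then 1 else 0)"
  shows
    "((m \<in> supermodular_funs N \<longleftrightarrow> r \<in> supermodular_funs M \<and> r L \<ge> r M)
     \<and> (\<forall>(a, b, C)\<in>triplets N.
          ({x, y} \<inter> C \<noteq> {} \<longrightarrow>
             ((a, b, C) \<in> indep_model N m \<longleftrightarrow>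
                indep r ({a} \<inter> L) ({b} \<inter> L) ({z} \<union> (C \<inter> L))))
        \<and> ({a} \<union> {b} \<union> C \<subseteq> L \<longrightarrow>
             ((a, b, C) \<in> indep_model N m \<longleftrightarrow> indep r {a} {b} C))
        \<and> (card ({x, y} \<inter> {a, b}) = 1 \<and> {x, y} \<inter> C = {} \<longrightarrow>
             ((a, b, C) \<in> indep_model N m \<longleftrightarrow> indep r {z} ({a, b} \<inter> L) C))
        \<and> ({x, y} = {a, b} \<longrightarrow>
             ((a, b, C) \<in> indep_model N m \<longleftrightarrow> r ({z} \<union> C) = r C))))
     \<and>
     ((r \<in> u_standardized M \<longrightarrow> m \<in> u_standardized N)
     \<and> (r \<in> u_standardized M \<longrightarrow> (is_extreme M r \<longleftrightarrow> is_extreme N m)))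
     \<and>
     ((is_extreme M r \<and> r L = r M \<longrightarrow>
          is_extreme N m \<and> quant_equiv N m (upper_repl N L z (upper_std M r)))
     \<and> (is_extreme N m \<longrightarrow>
          (is_extreme M r \<and> r L = r M)
          \<or> (r L > r M \<and> r \<in> modular_funs M
              \<and> quant_equiv N m (\<lambda>T\<in>Pow N. (r L - r M) * v T))))"
proof -
  interpret replication N M L x y z
    using assms by unfold_locales auto
  have sup: "m \<in> supermodular_funs N \<longleftrightarrow> r \<in> supermodular_funs M \<and> r L \<ge> r M"
    using \<open>r \<in> fun_space M\<close> by (simp add: m_eq supermodular_funs_iff supermod_repl)
  have extreme: "is_extreme N m \<longleftrightarrow> is_extreme M r" if "r L = r M"
    unfolding m_eq using is_extreme_repl_iff[OF \<open>r \<in> fun_space M\<close> that] .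
  have deg: "r \<in> modular_funs M \<and> quant_equiv N m (\<lambda>T\<in>Pow N. (r L - r M) * v T)"
    if "is_extreme N m" "r M < r L"
    unfolding m_eq
    using extreme_repl_degenerate[OF that(1)[unfolded m_eq] that(2) \<open>r \<in> fun_space M\<close> v_eq] by blast
  \<comment> \<open>An extreme \<open>m\<close> is supermodular, so \<open>r M \<le> r L\<close> and
    only equality or strict inequality remains.\<close>
  have conv: "(is_extreme M r \<and> r L = r M)
      \<or> (r L > r M \<and> r \<in> modular_funs M \<and> quant_equiv N m (\<lambda>T\<in>Pow N. (r L - r M) * v T))"
    if "is_extreme N m"
    using that sup extreme deg[OF that] by (cases "r L = r M") (auto simp: is_extreme_def)
  show ?thesis
  proof (intro conjI)
    show "m \<in> supermodular_funs N \<longleftrightarrow> r \<in> supermodular_funs M \<and> r L \<ge> r M" by (rule sup)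
    show "r \<in> u_standardized M \<longrightarrow> m \<in> u_standardized N"
      "r \<in> u_standardized M \<longrightarrow> (is_extreme M r \<longleftrightarrow> is_extreme N m)"
      using repl_u_standardized extreme by (auto simp: m_eq)
    show "is_extreme M r \<and> r L = r M \<longrightarrow>
        is_extreme N m \<and> quant_equiv N m (upper_repl N L z (upper_std M r))"
      using extreme repl_quant_equiv_upper_std m_eq by blast
    show "is_extreme N m \<longrightarrow> (is_extreme M r \<and> r L = r M)
        \<or> (r L > r M \<and> r \<in> modular_funs M \<and> quant_equiv N m (\<lambda>T\<in>Pow N. (r L - r M) * v T))"
      using conv by blast
  qed (unfold m_eq, rule ballI, unfold split_paired_all case_prod_conv, intro conjI impI,
      (rule indep_model_repl; assumption)+)
qed

end
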